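(* Let $m$ be a positive integer and suppose $J,K\subseteq\{0,1,\ldots,m-1\}$ with $|J|=|K|=3$. Then $H_{J,K}$ is a Hadamard submatrix of $\mathcal{F}_m$ if and only if $$\nu_3^{\min}(\mathcal{P}_m(J)\setminus\{1\})+\nu_3^{\min}(\mathcal{P}_m(K)\setminus\{1\})=\nu_3^{\max}(\mathcal{P}_m(J)\setminus\{1\})+\nu_3^{\max}(\mathcal{P}_m(K)\setminus\{1\})=\nu_3(m)+1$$ and $$\nu_p^{\max}(\mathcal{P}_m(J)\setminus\{1\})+\nu_p^{\max}(\mathcal{P}_m(K)\setminus\{1\})\leq\nu_p(m)$$ for all primes $p$ other than $3$.
   Context: $\mathcal{F}_m=(e^{2\pi i jk/m})_{0\le j,k\le m-1}$ is the $m\times m$ Fourier matrix. For $J,K\subseteq\{0,\ldots,m-1\}$ with $|J|=|K|=n$, $H_{J,K}=H_{J,K,m}=(e^{2\pi i jk/m})_{j\in J,k\in K}$ is the $n\times n$ submatrix of $\mathcal{F}_m$ with rows $J$ and columns $K$ (each listed in increasing order). An $n\times n$ complex matrix $H$ is Hadamard if all its entries have modulus $1$ and $H^*H=HH^*=nI_n$. For a nonempty finite set $X$ of nonnegative integers, $\mathcal{D}(X)=\{x_1-x_2:x_1,x_2\in X\}$ and $\mathcal{P}_m(X)=\left\{\frac{m}{\gcd(m,d)}:d\in\mathcal{D}(X)\right\}$ (with $\gcd(m,0)=m$). For a prime $p$ and a nonzero integer $n$, $\nu_p(n)=\max\{v\ge 0: p^v\mid n\}$; for a set $X$ of nonzero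 integers, $\nu_p^{\max}(X)=\max\{\nu_p(n):n\in X\}$ and $\nu_p^{\min}(X)=\min\{\nu_p(n):n\in X\}$. *)

theory Defs
  imports
    Complex_Main
    "HOL-Computational_Algebra.Primes"
    "Jordan_Normal_Form.DL_Submatrix"
    "Jordan_Normal_Form.Schur_Decomposition"
begin

definition fourier_mat :: "nat \<Rightarrow> complex mat" where
  "fourier_mat m =
     mat m m (\<lambda>(j, k). exp (2 * of_real pi * \<i> * of_nat j * of_nat k / of_nat m))"

(* For J, K within {..<m}, submatrix lists the selected rows and columns in increasing order. *)
definition fourier_submat :: "nat \<Rightarrow> nat set \<Rightarrow> nat set \<Rightarrow> complex mat" where
  "fourier_submat m J K = submatrix (fourier_mat m) J K"

definition hadamard_mat :: "nat \<Rightarrow> complex mat \<Rightarrow> bool" where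
  "hadamard_mat n H \<longleftrightarrow>
     H \<in> carrier_mat n n \<and>
     (\<forall>i<n. \<forall>j<n. cmod (H $$ (i, j)) = 1) \<and>
     mat_adjoint H * H = of_nat n \<cdot>\<^sub>m 1\<^sub>m n \<and>
     H * mat_adjoint H = of_nat n \<cdot>\<^sub>m 1\<^sub>m n"

(* Differences are taken in the integers, since subtraction on nat truncates. *)
definition difference_set :: "nat set \<Rightarrow> int set" where
  "difference_set X = {int x - int y | x y. x \<in> X \<and> y \<in> X}"

(* The division is exact, and d = 0 contributes 1 because gcd m 0 = m. *)
definition order_set :: "nat \<Rightarrow> nat set \<Rightarrow> nat set" where
  "order_set m X = {m div gcd m (nat \<bar>d\<bar>) | d. d \<in> difference_set X}"

(* Meaningful only for finite nonempty sets of nonzero numbers: Max and Min are unspecified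
   on the empty set, and multiplicity p 0 = 0 by convention. *)
definition nu_max :: "nat \<Rightarrow> nat set \<Rightarrow> nat" where
  "nu_max p X = Max (multiplicity p ` X)"

definition nu_min :: "nat \<Rightarrow> nat set \<Rightarrow> nat" where
  "nu_min p X = Min (multiplicity p ` X)"

end

theory Submission
  imports Defs "HOL-Library.Real_Mod"
begin

text \<open>
  Put \<open>\<omega> = exp (2 * pi * \<i> / m)\<close>. Rows \<open>j\<close> and \<open>j'\<close> of the submatrix are orthogonal iff the three
  numbers \<open>\<omega> ^ ((j - j') * k)\<close>, \<open>k \<in> K\<close>, add up to zero. Three complex numbers of modulus one do so
  if and only if they are the corners of an equilateral triangle, that is, if the quotient of any two of
  them is a primitive cube root of unity (\<open>sum_three_unit_eq_0_iff\<close>). The orthogonality of the rows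
  thus becomes a condition on pairs of differences: for all nonzero \<open>d \<in> \<D>(J)\<close> and \<open>e \<in> \<D>(K)\<close>, the
  number \<open>\<omega> ^ (d * e)\<close> is a primitive cube root of unity, i.e. \<open>m\<close> divides \<open>3 * d * e\<close> but not
  \<open>d * e\<close> (\<open>hadamard_3_fourier_submat_iff_dvd\<close>).

  At a prime \<open>p\<close>, write \<open>\<nu>\<close> for the valuation at \<open>p\<close>. The divisibility condition says
  \<open>\<nu>(d) + \<nu>(e) \<ge> \<nu>(m)\<close> if \<open>p \<noteq> 3\<close>, and \<open>\<nu>(d) + \<nu>(e) = \<nu>(m) - 1\<close> if \<open>p = 3\<close>. The order
  \<open>m / gcd(m, d)\<close> of \<open>\<omega> ^ d\<close> has valuation \<open>\<nu>(m) - min (\<nu>(m)) (\<nu>(d))\<close>, and the truncation by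
  \<open>\<nu>(m)\<close> does not change the truth of these conditions, so in terms of the two orders they read
  "the valuations add up to at most \<open>\<nu>(m)\<close>" and "the valuations add up to exactly \<open>\<nu>(m) + 1\<close>"
  (\<open>dvd_triple_not_dvd_iff_orders\<close>).

  As \<open>d\<close> and \<open>e\<close> vary independently, their orders run through all pairs from
  \<open>\<P>(J) - {1}\<close> and \<open>\<P>(K) - {1}\<close>. An upper bound on all the sums of two valuations is an upper
  bound on the sum of the maxima, and a constant sum means that the sum of the minima and the sum of
  the maxima both equal that constant.
\<close>

section \<open>Sums of three numbers of modulus one\<close>

text \<open>
  For numbers of modulus one, complex conjugation is inversion. Conjugating \<open>a + b + c = 0\<close> therefore
  gives \<open>1 / a + 1 / b + 1 / c = 0\<close>, so that the second elementary symmetric function vanishes along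
  with the first. The three numbers are then the roots of \<open>x ^ 3 - a * b * c\<close>. They are distinct,
  because \<open>a = b\<close> would force \<open>c = - 2 * a\<close>, which has modulus two.
\<close>

lemma sum_three_unit_eq_0_iff:
  fixes a b c :: complex
  assumes "cmod a = 1" "cmod b = 1" "cmod c = 1"
  shows "a + b + c = 0 \<longleftrightarrow>
    a ^ 3 = b ^ 3 \<and> b ^ 3 = c ^ 3 \<and> a \<noteq> b \<and> b \<noteq> c \<and> a \<noteq> c"
proof
  assume sum: "a + b + c = 0"
  have inv: "cnj z = 1 / z" if "cmod z = 1" for z
    using that by (metis complex_div_cnj div_by_1 mult_1 of_real_1 power_one)
  have nz: "a \<noteq> 0" "b \<noteq> 0" "c \<noteq> 0"
    using assms by auto
  have "cnj (a + b + c) = 0"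
    using sum by simp
  then have "1 / a + 1 / b + 1 / c = 0"
    using assms by (simp add: inv)
  then have e2: "a * b + b * c + c * a = 0"
    using nz by (simp add: divide_simps) (simp add: algebra_simps)
  have cube: "x ^ 3 = x * y * z" if "x + y + z = 0" "x * y + y * z + z * x = 0" for x y z :: complex
  proof -
    have "x ^ 3 - x * y * z = x * (x * (x + y + z) - (x * y + y * z + z * x))"
      by (simp add: algebra_simps power3_eq_cube)
    then show ?thesis
      using that by simp
  qed
  have cubes: "a ^ 3 = a * b * c" "b ^ 3 = a * b * c" "c ^ 3 = a * b * c"
    using cube[of a b c] cube[of b c a] cube[of c a b] sum e2 by (simp_all add: ac_simps)
  have "x \<noteq> y" if "x + y + z = 0" "cmod x = 1" "cmod z = 1" for x y z :: complex
  proof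
    assume "x = y"
    then have "z = - 2 * x"
      using that(1) by (simp add: eq_neg_iff_add_eq_0 ac_simps)
    then show False
      using that(2,3) by (simp add: norm_mult)
  qed
  moreover have "b + c + a = 0" "a + c + b = 0"
    using sum by (simp_all add: add_ac)
  ultimately have "a \<noteq> b" "b \<noteq> c" "a \<noteq> c"
    using sum assms by blast+
  with cubes show "a ^ 3 = b ^ 3 \<and> b ^ 3 = c ^ 3 \<and> a \<noteq> b \<and> b \<noteq> c \<and> a \<noteq> c"
    by metis
next
  assume *: "a ^ 3 = b ^ 3 \<and> b ^ 3 = c ^ 3 \<and> a \<noteq> b \<and> b \<noteq> c \<and> a \<noteq> c"
  have quad: "x ^ 2 + x * y + y ^ 2 = 0" if "x ^ 3 = y ^ 3" "x \<noteq> y" for x y :: complex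
  proof -
    have "(x - y) * (x ^ 2 + x * y + y ^ 2) = 0"
      using that(1) by (simp add: algebra_simps power2_eq_square power3_eq_cube)
    then show ?thesis
      using that(2) by simp
  qed
  (* Both b and c are roots of x ^ 2 + a * x + a ^ 2, so b + c = - a by Vieta. *)
  have "(b - c) * (a + b + c) = (a ^ 2 + a * b + b ^ 2) - (a ^ 2 + a * c + c ^ 2)"
    by (simp add: algebra_simps power2_eq_square)
  also have "\<dots> = 0"
    using quad[of a b] quad[of a c] * by simp
  finally have "(b - c) * (a + b + c) = 0" .
  then show "a + b + c = 0"
    using * by simp
qed

lemma sum_card_3_unit_eq_0_iff:
  fixes f :: "'a \<Rightarrow> complex"
  assumes "card K = 3" and "\<And>k. k \<in> K \<Longrightarrow> cmod (f k) = 1"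
  shows "(\<Sum>k\<in>K. f k) = 0 \<longleftrightarrow>
    (\<forall>k\<in>K. \<forall>l\<in>K. k \<noteq> l \<longrightarrow> f k \<noteq> f l \<and> f k ^ 3 = f l ^ 3)"
proof -
  obtain x y z where K: "K = {x, y, z}" "x \<noteq> y" "y \<noteq> z" "x \<noteq> z"
    using assms(1) by (auto simp: card_3_iff)
  have "(\<Sum>k\<in>K. f k) = f x + f y + f z"
    using K by simp
  also have "\<dots> = 0 \<longleftrightarrow>
      f x ^ 3 = f y ^ 3 \<and> f y ^ 3 = f z ^ 3 \<and> f x \<noteq> f y \<and> f y \<noteq> f z \<and> f x \<noteq> f z"
    using assms(2) K(1) by (intro sum_three_unit_eq_0_iff) simp_all
  also have "\<dots> \<longleftrightarrow> (\<forall>k\<in>K. \<forall>l\<in>K. k \<noteq> l \<longrightarrow> f k \<noteq> f l \<and> f k ^ 3 = f l ^ 3)"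
    unfolding K(1) using K(2-4) by (simp only: ball_simps) metis
  finally show ?thesis .
qed

section \<open>Hadamard submatrices of the Fourier matrix\<close>

definition unity_root :: "nat \<Rightarrow> int \<Rightarrow> complex" where
  "unity_root m d = cis (2 * pi * of_int d / of_nat m)"

lemma norm_unity_root [simp]: "cmod (unity_root m d) = 1"
  by (simp add: unity_root_def)

lemma unity_root_nonzero [simp]: "unity_root m d \<noteq> 0"
  by (simp add: unity_root_def)

lemma cnj_unity_root: "cnj (unity_root m d) = unity_root m (- d)"
  by (simp add: unity_root_def cis_cnj)

lemma unity_root_add: "unity_root m (d + e) = unity_root m d * unity_root m e"
  by (simp add: unity_root_def cis_mult add_divide_distrib ring_distribs)

lemma unity_root_power: "unity_root m d ^ n = unity_root m (int n * d)"
  by (simp add: unity_root_def DeMoivre algebra_simps)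

lemma unity_root_eq_1_iff:
  assumes "m > 0"
  shows "unity_root m d = 1 \<longleftrightarrow> int m dvd d"
proof -
  have "unity_root m d = 1 \<longleftrightarrow> (\<exists>n. 2 * pi * of_int d / of_nat m = of_int n * (2 * pi))"
    unfolding unity_root_def by (rule cis_eq_1_iff)
  also have "\<dots> \<longleftrightarrow> (\<exists>n. (of_int d :: real) = of_int (int m * n))"
    using assms by (simp add: divide_simps mult.commute)
  also have "\<dots> \<longleftrightarrow> int m dvd d"
    unfolding of_int_eq_iff dvd_def ..
  finally show ?thesis .
qed

lemma unity_root_eq_iff:
  assumes "m > 0"
  shows "unity_root m d = unity_root m e \<longleftrightarrow> int m dvd d - e"
proof -
  have "unity_root m d = unity_root m (d - e) * unity_root m e"
    by (simp flip: unity_root_add)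
  then have "unity_root m d = unity_root m e \<longleftrightarrow> unity_root m (d - e) = 1"
    by (metis mult_cancel_right1 mult_1 unity_root_nonzero)
  then show ?thesis
    by (simp only: unity_root_eq_1_iff[OF assms])
qed

text \<open>
  The matrix entries are indexed by positions in the sorted sets \<open>J\<close> and \<open>K\<close>. This bijection turns
  sums over positions into sums over the sets themselves.
\<close>

lemma bij_betw_pick:
  assumes "finite S"
  shows "bij_betw (pick S) {..<card S} S"
proof -
  have inj: "inj_on (pick S) {..<card S}"
    by (rule strict_mono_on_imp_inj_on) (simp add: strict_mono_on_def pick_mono)
  have "pick S ` {..<card S} \<subseteq> S"
    by (auto intro: pick_in_set)
  moreover have "card (pick S ` {..<card S}) = card S"
    using inj by (simp add: card_image)
  ultimately show ?thesis
    using inj assms by (simp add: bij_betw_def card_subset_eq)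
qed

lemma fourier_submat_carrier:
  assumes "J \<subseteq> {0..<m}" "K \<subseteq> {0..<m}"
  shows "fourier_submat m J K \<in> carrier_mat (card J) (card K)"
proof -
  have "{i. i < m \<and> i \<in> J} = J" "{i. i < m \<and> i \<in> K} = K"
    using assms by auto
  then show ?thesis
    by (intro carrier_matI) (simp_all add: fourier_submat_def fourier_mat_def dim_submatrix)
qed

lemma fourier_submat_index:
  assumes "J \<subseteq> {0..<m}" "K \<subseteq> {0..<m}" "i < card J" "k < card K"
  shows "fourier_submat m J K $$ (i, k) = unity_root m (int (pick J i) * int (pick K k))"
proof -
  have "{i. i < m \<and> i \<in> J} = J" "{i. i < m \<and> i \<in> K} = K"
    using assms by auto
  moreover have "pick J i < m" "pick K k < m"
    using assms pick_in_set[of i J] pick_in_set[of k K] by auto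
  ultimately show ?thesis
    using assms(3,4)
    by (simp add: fourier_submat_def fourier_mat_def submatrix_index unity_root_def
        cis_conv_exp mult_ac)
qed

lemma mat_adjoint_index:
  assumes "A \<in> carrier_mat n k" "i < k" "j < n"
  shows "mat_adjoint A $$ (i, j) = conjugate (A $$ (j, i))"
  using assms by (simp add: mat_adjoint_def mat_of_rows_index)

lemma mat_adjoint_carrier:
  "A \<in> carrier_mat n k \<Longrightarrow> mat_adjoint A \<in> carrier_mat k n"
  by (auto simp: mat_adjoint_def)

text \<open>
  Orthogonality of the rows alone suffices: it says that \<open>(1 / n) H\<^sup>*\<close> is a right inverse of the
  square matrix \<open>H\<close>, and a right inverse is also a left inverse.
\<close>

lemma hadamard_mat_iff_rows_orthogonal:
  assumes H: "H \<in> carrier_mat n n" and unit: "\<And>i k. i < n \<Longrightarrow> k < n \<Longrightarrow> cmod (H $$ (i, k)) = 1"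
  shows "hadamard_mat n H \<longleftrightarrow>
    (\<forall>i<n. \<forall>j<n. i \<noteq> j \<longrightarrow> (\<Sum>k<n. H $$ (i, k) * cnj (H $$ (j, k))) = 0)"
proof -
  note H' = mat_adjoint_carrier[OF H]
  have prod: "(H * mat_adjoint H) $$ (i, j) = (\<Sum>k<n. H $$ (i, k) * cnj (H $$ (j, k)))"
    if "i < n" "j < n" for i j
    using that H H'
    by (auto simp: scalar_prod_def mat_adjoint_index[OF H] lessThan_atLeast0 intro!: sum.cong)
  have diag: "(\<Sum>k<n. H $$ (i, k) * cnj (H $$ (i, k))) = of_nat n" if "i < n" for i
    using that unit by (simp flip: complex_norm_square)
  have gram: "H * mat_adjoint H = of_nat n \<cdot>\<^sub>m 1\<^sub>m n \<longleftrightarrow>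
    (\<forall>i<n. \<forall>j<n. i \<noteq> j \<longrightarrow> (\<Sum>k<n. H $$ (i, k) * cnj (H $$ (j, k))) = 0)" (is "?L = ?R")
  proof
    assume L: ?L
    show ?R
    proof (intro allI impI)
      fix i j assume "i < n" "j < n" "i \<noteq> j"
      then show "(\<Sum>k<n. H $$ (i, k) * cnj (H $$ (j, k))) = 0"
        using prod[of i j] by (simp add: L)
    qed
  next
    assume ?R
    then show ?L
      using H H' prod diag by (intro eq_matI) auto
  qed
  have "mat_adjoint H * H = of_nat n \<cdot>\<^sub>m 1\<^sub>m n" if L: "H * mat_adjoint H = of_nat n \<cdot>\<^sub>m 1\<^sub>m n"
    (* The inverse is scaled by 1 / n, so the empty matrix is treated separately. *)
  proof (cases "n = 0")
    case True
    then show ?thesis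
      using H H' by (intro eq_matI) auto
  next
    case False
    define G where "G = (1 / of_nat n :: complex) \<cdot>\<^sub>m mat_adjoint H"
    have G: "G \<in> carrier_mat n n"
      using H' by (simp add: G_def)
    have "H * G = 1\<^sub>m n"
      using H H' L False
      by (simp add: G_def mult_smult_distrib[of _ n n _ n]) (auto intro!: eq_matI)
    then have "G * H = 1\<^sub>m n"
      using mat_mult_left_right_inverse[OF H G] by simp
    moreover have "mat_adjoint H = of_nat n \<cdot>\<^sub>m G"
      using False by (auto simp: G_def intro!: eq_matI)
    ultimately show ?thesis
      using mult_smult_assoc_mat[OF G H] by simp
  qed
  moreover have "\<forall>i<n. \<forall>k<n. cmod (H $$ (i, k)) = 1"
    using unit by simp
  ultimately have "hadamard_mat n H \<longleftrightarrow> H * mat_adjoint H = of_nat n \<cdot>\<^sub>m 1\<^sub>m n"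
    unfolding hadamard_mat_def using H by argo
  also note gram
  finally show ?thesis .
qed

lemma hadamard_fourier_submat_iff:
  assumes J: "J \<subseteq> {0..<m}" and K: "K \<subseteq> {0..<m}" and n: "card J = n" "card K = n"
  shows "hadamard_mat n (fourier_submat m J K) \<longleftrightarrow>
    (\<forall>j\<in>J. \<forall>j'\<in>J. j \<noteq> j' \<longrightarrow> (\<Sum>k\<in>K. unity_root m ((int j - int j') * int k)) = 0)"
proof -
  let ?H = "fourier_submat m J K"
  note index = fourier_submat_index[OF J K, unfolded n]
  have "finite J" "finite K"
    using J K by (auto intro: finite_subset)
  note bJ = bij_betw_pick[OF this(1), unfolded n] and bK = bij_betw_pick[OF this(2), unfolded n]
  have row: "(\<Sum>k<n. ?H $$ (i, k) * cnj (?H $$ (j, k)))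
      = (\<Sum>k\<in>K. unity_root m ((int (pick J i) - int (pick J j)) * int k))"
    if "i < n" "j < n" for i j
  proof -
    have "(\<Sum>k<n. ?H $$ (i, k) * cnj (?H $$ (j, k)))
        = (\<Sum>k<n. unity_root m ((int (pick J i) - int (pick J j)) * int (pick K k)))"
      using that
      by (intro sum.cong) (auto simp: index cnj_unity_root left_diff_distrib simp flip: unity_root_add)
    also have "\<dots> = (\<Sum>k\<in>K. unity_root m ((int (pick J i) - int (pick J j)) * int k))"
      by (rule sum.reindex_bij_betw[OF bK])
    finally show ?thesis .
  qed
  have img: "J = pick J ` {..<n}"
    using bJ by (simp add: bij_betw_def)
  have inj: "pick J i = pick J j \<longleftrightarrow> i = j" if "i < n" "j < n" for i j
    using bJ that by (auto simp: bij_betw_def inj_on_def)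
  have carrier: "?H \<in> carrier_mat n n"
    using fourier_submat_carrier[OF J K] n by simp
  have unit: "cmod (?H $$ (i, k)) = 1" if "i < n" "k < n" for i k
    using that by (simp add: index)
  have "hadamard_mat n ?H \<longleftrightarrow>
      (\<forall>i<n. \<forall>j<n. i \<noteq> j \<longrightarrow>
        (\<Sum>k\<in>K. unity_root m ((int (pick J i) - int (pick J j)) * int k)) = 0)"
    using hadamard_mat_iff_rows_orthogonal[OF carrier] unit row by simp
  also have "\<dots> \<longleftrightarrow> (\<forall>j\<in>pick J ` {..<n}. \<forall>j'\<in>pick J ` {..<n}. j \<noteq> j' \<longrightarrow>
      (\<Sum>k\<in>K. unity_root m ((int j - int j') * int k)) = 0)"
    using inj by auto
  finally show ?thesis
    unfolding img[symmetric] .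
qed

lemma ball_difference_set_minus_0:
  "(\<forall>d\<in>difference_set X - {0}. P d) \<longleftrightarrow> (\<forall>x\<in>X. \<forall>y\<in>X. x \<noteq> y \<longrightarrow> P (int x - int y))"
  unfolding difference_set_def by force

text \<open>
  The condition is symmetric in \<open>J\<close> and \<open>K\<close>. Within a row pair with difference \<open>d\<close>, the quotient of
  the terms for \<open>k\<close> and \<open>l\<close> is the root of unity with exponent \<open>d * (k - l)\<close>. It has to be a cube
  root of unity other than 1.
\<close>

lemma hadamard_3_fourier_submat_iff_dvd:
  assumes "m > 0" and J: "J \<subseteq> {0..<m}" and K: "K \<subseteq> {0..<m}" and "card J = 3" "card K = 3"
  shows "hadamard_mat 3 (fourier_submat m J K) \<longleftrightarrow>
    (\<forall>d\<in>difference_set J - {0}. \<forall>e\<in>difference_set K - {0}.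
      \<not> int m dvd d * e \<and> int m dvd 3 * (d * e))"
proof -
  have row: "(\<Sum>k\<in>K. unity_root m (d * int k)) = 0 \<longleftrightarrow>
      (\<forall>e\<in>difference_set K - {0}. \<not> int m dvd d * e \<and> int m dvd 3 * (d * e))" for d
  proof -
    have "(\<Sum>k\<in>K. unity_root m (d * int k)) = 0 \<longleftrightarrow>
      (\<forall>k\<in>K. \<forall>l\<in>K. k \<noteq> l \<longrightarrow>
        \<not> int m dvd d * (int k - int l) \<and> int m dvd 3 * (d * (int k - int l)))"
      using assms
      by (subst sum_card_3_unit_eq_0_iff)
        (auto simp: unity_root_power unity_root_eq_iff right_diff_distrib)
    then show ?thesis
      unfolding ball_difference_set_minus_0 .
  qed
  show ?thesis
    unfolding hadamard_fourier_submat_iff[OF J K assms(4,5)] row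
    by (simp add: ball_difference_set_minus_0)
qed

section \<open>The divisibility condition one prime at a time\<close>

text \<open>
  The valuation of the order of \<open>d\<close> modulo \<open>m\<close>, in additive form so that no truncated subtraction
  occurs.
\<close>

lemma multiplicity_div_gcd:
  fixes m d p :: nat
  assumes "m > 0" "d > 0" "prime p"
  shows "multiplicity p (m div gcd m d) + min (multiplicity p m) (multiplicity p d) = multiplicity p m"
proof -
  have "multiplicity p (gcd m d) = count (prime_factorization (gcd m d)) p"
    using assms(3) by (rule count_prime_factorization_prime[symmetric])
  also have "\<dots> = min (multiplicity p m) (multiplicity p d)"
    using assms(1,2)
    by (simp add: prime_factorization_gcd count_prime_factorization_prime[OF assms(3)])
  finally have gcd: "multiplicity p (gcd m d) = min (multiplicity p m) (multiplicity p d)" .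
  have "multiplicity p m = multiplicity p (m div gcd m d * gcd m d)"
    by simp
  also have "\<dots> = multiplicity p (m div gcd m d) + multiplicity p (gcd m d)"
    using assms by (intro prime_elem_multiplicity_mult_distrib) (auto simp: dvd_div_eq_0_iff)
  finally show ?thesis
    by (simp add: gcd)
qed

text \<open>
  The factor 3 only affects the prime 3. At every other prime, both divisibilities impose the same
  inequality. Hence if one of them holds and the other fails, the difference comes from the prime 3,
  where \<open>\<nu>(m) \<le> \<nu>(n) + 1\<close> and \<open>\<nu>(m) > \<nu>(n)\<close> leave a single value.
\<close>

lemma dvd_triple_not_dvd_iff_multiplicity:
  fixes m n :: nat
  assumes "m > 0" "n > 0"
  shows "\<not> m dvd n \<and> m dvd 3 * n \<longleftrightarrow>
    multiplicity 3 m = multiplicity 3 n + 1 \<and>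
    (\<forall>p. prime p \<and> p \<noteq> 3 \<longrightarrow> multiplicity p m \<le> multiplicity p n)"
proof -
  have p3: "prime (3 :: nat)"
    by simp
  have dvd_iff: "m dvd k \<longleftrightarrow> (\<forall>p. prime p \<longrightarrow> multiplicity p m \<le> multiplicity p k)" if "k > 0" for k
    using that assms(1) by (auto intro: dvd_imp_multiplicity_le multiplicity_le_imp_dvd)
  have triple: "multiplicity p (3 * n) = (if p = 3 then Suc (multiplicity p n) else multiplicity p n)"
    if "prime p" for p
    using that assms(2) p3
    by (auto simp: prime_elem_multiplicity_mult_distrib prime_multiplicity_other)
  have "m dvd 3 * n \<longleftrightarrow> multiplicity 3 m \<le> Suc (multiplicity 3 n) \<and>
      (\<forall>p. prime p \<and> p \<noteq> 3 \<longrightarrow> multiplicity p m \<le> multiplicity p n)"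
    using assms(2) p3 by (subst dvd_iff) (auto simp: triple split: if_splits)
  moreover have "m dvd n \<longleftrightarrow> multiplicity 3 m \<le> multiplicity 3 n \<and>
      (\<forall>p. prime p \<and> p \<noteq> 3 \<longrightarrow> multiplicity p m \<le> multiplicity p n)"
    using assms(2) p3 by (subst dvd_iff) auto
  ultimately show ?thesis
    by auto
qed

text \<open>
  Let \<open>M\<close>, \<open>D\<close>, \<open>E\<close> be the valuations of \<open>m\<close>, \<open>d\<close>, \<open>e\<close>. Those of the two orders are \<open>M - min M D\<close> and
  \<open>M - min M E\<close>, so the claims are \<open>D + E \<ge> M \<longleftrightarrow> min M D + min M E \<ge> M\<close> and
  \<open>D + E + 1 = M \<longleftrightarrow> min M D + min M E + 1 = M\<close>. The minima matter only if \<open>D \<ge> M\<close> or \<open>E \<ge> M\<close>, and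
  then both inequalities are true and both equations are false.
\<close>

lemma dvd_triple_not_dvd_iff_orders:
  fixes m d e :: nat
  assumes "m > 0" "d > 0" "e > 0"
  shows "\<not> m dvd d * e \<and> m dvd 3 * (d * e) \<longleftrightarrow>
    multiplicity 3 (m div gcd m d) + multiplicity 3 (m div gcd m e) = multiplicity 3 m + 1 \<and>
    (\<forall>p. prime p \<and> p \<noteq> 3 \<longrightarrow>
      multiplicity p (m div gcd m d) + multiplicity p (m div gcd m e) \<le> multiplicity p m)"
proof -
  have p3: "prime (3 :: nat)"
    by simp
  have mult: "multiplicity p (d * e) = multiplicity p d + multiplicity p e" if "prime p" for p
    using that assms by (simp add: prime_elem_multiplicity_mult_distrib)
  have other: "multiplicity p m \<le> multiplicity p (d * e) \<longleftrightarrow>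
      multiplicity p (m div gcd m d) + multiplicity p (m div gcd m e) \<le> multiplicity p m"
    if "prime p" for p
    using multiplicity_div_gcd[OF assms(1,2) that] multiplicity_div_gcd[OF assms(1,3) that]
      mult[OF that] by linarith
  have three: "multiplicity 3 m = multiplicity 3 (d * e) + 1 \<longleftrightarrow>
      multiplicity 3 (m div gcd m d) + multiplicity 3 (m div gcd m e) = multiplicity 3 m + 1"
    using multiplicity_div_gcd[OF assms(1,2) p3] multiplicity_div_gcd[OF assms(1,3) p3]
      mult[OF p3] by linarith
  show ?thesis
    using assms other three by (subst dvd_triple_not_dvd_iff_multiplicity) auto
qed

text \<open>
  Removing the order 1 is the same as removing the difference 0, since nonzero differences of
  residues below \<open>m\<close> are not divisible by \<open>m\<close>.
\<close>

lemma order_set_minus_1: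
  assumes "X \<subseteq> {0..<m}"
  shows "order_set m X - {1} = (\<lambda>d. m div gcd m (nat \<bar>d\<bar>)) ` (difference_set X - {0})"
proof -
  have "m div gcd m (nat \<bar>d\<bar>) = 1 \<longleftrightarrow> d = 0" if d: "d \<in> difference_set X" for d
  proof
    obtain x y where xy: "d = int x - int y" "x \<in> X" "y \<in> X"
      using d unfolding difference_set_def by blast
    then have "x < m" "y < m"
      using assms by auto
    then have small: "nat \<bar>d\<bar> < m"
      using xy(1) by linarith
    assume "m div gcd m (nat \<bar>d\<bar>) = 1"
    then have "m dvd nat \<bar>d\<bar>"
      using dvd_div_mult_self[of "gcd m (nat \<bar>d\<bar>)" m] by (metis gcd_dvd1 gcd_dvd2 mult_1)
    then have "nat \<bar>d\<bar> = 0"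
      using small by (meson dvd_imp_le gr0I leD)
    then show "d = 0"
      by simp
  next
    assume "d = 0"
    moreover have "m > 0"
      using d assms unfolding difference_set_def by auto
    ultimately show "m div gcd m (nat \<bar>d\<bar>) = 1"
      by simp
  qed
  then show ?thesis
    by (auto simp: order_set_def)
qed

lemma finite_difference_set:
  assumes "finite X"
  shows "finite (difference_set X)"
proof -
  have "difference_set X = (\<lambda>(x, y). int x - int y) ` (X \<times> X)"
    by (auto simp: difference_set_def)
  then show ?thesis
    using assms by simp
qed

lemma order_set_minus_1_finite_nonempty:
  assumes "X \<subseteq> {0..<m}" "card X > 1"
  shows "finite (order_set m X - {1})" "order_set m X - {1} \<noteq> {}"
proof -
  have "finite X"
    using assms(2) by (simp add: card_ge_0_finite)
  then show "finite (order_set m X - {1})"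
    unfolding order_set_minus_1[OF assms(1)] by (simp add: finite_difference_set)
  obtain x y where "x \<in> X" "y \<in> X" "x \<noteq> y"
    using assms(2) by (metis One_nat_def card_le_Suc0_iff_eq \<open>finite X\<close> not_le)
  then have "int x - int y \<in> difference_set X - {0}"
    by (auto simp: difference_set_def)
  then show "order_set m X - {1} \<noteq> {}"
    unfolding order_set_minus_1[OF assms(1)] by blast
qed

section \<open>Extreme valuations\<close>

lemma nu_max_add_le_iff:
  assumes "finite A" "A \<noteq> {}" "finite B" "B \<noteq> {}"
  shows "nu_max p A + nu_max p B \<le> c \<longleftrightarrow>
    (\<forall>a\<in>A. \<forall>b\<in>B. multiplicity p a + multiplicity p b \<le> c)"
proof
  assume le: "nu_max p A + nu_max p B \<le> c"
  have "multiplicity p a \<le> nu_max p A" if "a \<in> A" for a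
    unfolding nu_max_def using assms that by simp
  moreover have "multiplicity p b \<le> nu_max p B" if "b \<in> B" for b
    unfolding nu_max_def using assms that by simp
  ultimately show "\<forall>a\<in>A. \<forall>b\<in>B. multiplicity p a + multiplicity p b \<le> c"
    using le by (meson add_mono order_trans)
next
  assume all: "\<forall>a\<in>A. \<forall>b\<in>B. multiplicity p a + multiplicity p b \<le> c"
  have "nu_max p A \<in> multiplicity p ` A" "nu_max p B \<in> multiplicity p ` B"
    unfolding nu_max_def using assms by (auto intro!: Max_in)
  then show "nu_max p A + nu_max p B \<le> c"
    using all by auto
qed

lemma nu_min_add_ge_iff:
  assumes "finite A" "A \<noteq> {}" "finite B" "B \<noteq> {}"
  shows "c \<le> nu_min p A + nu_min p B \<longleftrightarrow>
    (\<forall>a\<in>A. \<forall>b\<in>B. c \<le> multiplicity p a + multiplicity p b)"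
proof
  assume le: "c \<le> nu_min p A + nu_min p B"
  have "nu_min p A \<le> multiplicity p a" if "a \<in> A" for a
    unfolding nu_min_def using assms that by simp
  moreover have "nu_min p B \<le> multiplicity p b" if "b \<in> B" for b
    unfolding nu_min_def using assms that by simp
  ultimately show "\<forall>a\<in>A. \<forall>b\<in>B. c \<le> multiplicity p a + multiplicity p b"
    using le by (meson add_mono order_trans)
next
  assume all: "\<forall>a\<in>A. \<forall>b\<in>B. c \<le> multiplicity p a + multiplicity p b"
  have "nu_min p A \<in> multiplicity p ` A" "nu_min p B \<in> multiplicity p ` B"
    unfolding nu_min_def using assms by (auto intro!: Min_in)
  then show "c \<le> nu_min p A + nu_min p B"
    using all by auto
qed

lemma nu_min_le_nu_max:
  assumes "finite A" "A \<noteq> {}"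
  shows "nu_min p A \<le> nu_max p A"
proof -
  obtain a where "a \<in> A"
    using assms(2) by blast
  then have "nu_min p A \<le> multiplicity p a" "multiplicity p a \<le> nu_max p A"
    unfolding nu_min_def nu_max_def using assms(1) by simp_all
  then show ?thesis
    by (rule order_trans)
qed

text \<open>
  Every pairwise sum equals \<open>c\<close> iff \<open>c\<close> is both a lower and an upper bound of these sums, that is, at
  most the sum of the minima and at least the sum of the maxima. As the minima never exceed the
  maxima, this forces equality throughout.
\<close>

lemma nu_min_max_add_eq_iff:
  assumes "finite A" "A \<noteq> {}" "finite B" "B \<noteq> {}"
  shows "nu_min p A + nu_min p B = nu_max p A + nu_max p B \<and> nu_max p A + nu_max p B = c \<longleftrightarrow>
    (\<forall>a\<in>A. \<forall>b\<in>B. multiplicity p a + multiplicity p b = c)"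
proof -
  have "nu_min p A + nu_min p B \<le> nu_max p A + nu_max p B"
    using assms by (intro add_mono nu_min_le_nu_max)
  then have "nu_min p A + nu_min p B = nu_max p A + nu_max p B \<and> nu_max p A + nu_max p B = c \<longleftrightarrow>
      c \<le> nu_min p A + nu_min p B \<and> nu_max p A + nu_max p B \<le> c"
    by auto
  then show ?thesis
    unfolding nu_min_add_ge_iff[OF assms] nu_max_add_le_iff[OF assms] by (auto intro: antisym)
qed

theorem theorem3p6:
  fixes m :: nat and J K :: "nat set"
  assumes "m > 0"
    and "J \<subseteq> {0..<m}" and "K \<subseteq> {0..<m}"
    and "card J = 3" and "card K = 3"
  shows "hadamard_mat 3 (fourier_submat m J K) \<longleftrightarrow>
    (nu_min 3 (order_set m J - {1}) + nu_min 3 (order_set m K - {1})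
       = nu_max 3 (order_set m J - {1}) + nu_max 3 (order_set m K - {1}) \<and>
     nu_max 3 (order_set m J - {1}) + nu_max 3 (order_set m K - {1})
       = multiplicity 3 m + 1) \<and>
    (\<forall>p::nat. prime p \<and> p \<noteq> 3 \<longrightarrow>
       nu_max p (order_set m J - {1}) + nu_max p (order_set m K - {1}) \<le> multiplicity p m)"
proof -
  let ?A = "order_set m J - {1}" and ?B = "order_set m K - {1}"
  have A: "finite ?A" "?A \<noteq> {}" and B: "finite ?B" "?B \<noteq> {}"
    using order_set_minus_1_finite_nonempty[OF assms(2)] order_set_minus_1_finite_nonempty[OF assms(3)]
      assms(4,5) by simp_all
  have dvd: "\<not> int m dvd d * e \<and> int m dvd 3 * (d * e) \<longleftrightarrow>
      multiplicity 3 (m div gcd m (nat \<bar>d\<bar>)) + multiplicity 3 (m div gcd m (nat \<bar>e\<bar>))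
        = multiplicity 3 m + 1 \<and>
      (\<forall>p. prime p \<and> p \<noteq> 3 \<longrightarrow>
        multiplicity p (m div gcd m (nat \<bar>d\<bar>)) + multiplicity p (m div gcd m (nat \<bar>e\<bar>))
          \<le> multiplicity p m)" if "d \<noteq> 0" "e \<noteq> 0" for d e
  proof -
    have "nat \<bar>d\<bar> * nat \<bar>e\<bar> = nat \<bar>d * e\<bar>" "3 * (nat \<bar>d\<bar> * nat \<bar>e\<bar>) = nat \<bar>3 * (d * e)\<bar>"
      by (simp_all add: nat_mult_distrib abs_mult)
    then show ?thesis
      using dvd_triple_not_dvd_iff_orders[of m "nat \<bar>d\<bar>" "nat \<bar>e\<bar>"] that \<open>m > 0\<close>
      by (simp only: dvd_nat_abs_iff) simp
  qed
  have "hadamard_mat 3 (fourier_submat m J K) \<longleftrightarrow>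
      (\<forall>a\<in>?A. \<forall>b\<in>?B. multiplicity 3 a + multiplicity 3 b = multiplicity 3 m + 1 \<and>
        (\<forall>p. prime p \<and> p \<noteq> 3 \<longrightarrow> multiplicity p a + multiplicity p b \<le> multiplicity p m))"
    unfolding hadamard_3_fourier_submat_iff_dvd[OF assms] order_set_minus_1[OF assms(2)]
      order_set_minus_1[OF assms(3)]
    by (simp add: dvd)
  then show ?thesis
    unfolding nu_min_max_add_eq_iff[OF A B] nu_max_add_le_iff[OF A B] by blast
qed

end
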